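(* Let $f_h^n=\sum_{j=1}^N f_j^n\psi_j\in\mathcal V_h$ be given, and let $f_1^{\mathsf L,n+1},\dots,f_N^{\mathsf L,n+1}$ be defined by the low-order scheme $$m_i\frac{f_i^{\mathsf L,n+1}-f_i^n}{\tau_n}+\sum_{j\in\mathcal I(i)}c_{ij}^n f_j^n-\sum_{j\in\mathcal I(i)}d_{ij}^{\mathsf L,n}f_j^n=0,\qquad i=1,\dots,N.$$ Suppose that the time step satisfies the CFL condition $$\tau_n=\mathrm{cfl}\,\min_{i=1,\dots,N}\frac{m_i}{\sum_{j\in\mathcal I(i),\,j\ne i}d_{ij}^{\mathsf L,n}}$$ with CFL number in the range $0<\mathrm{cfl}\le\tfrac12$. Then $$\min_{j\in\mathcal I(i)}f_j^n\;\le\; f_i^{\mathsf L,n+1}\;\le\;\max_{j\in\mathcal I(i)}f_j^n,\qquad i=1,\dots,N.$$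
   Context: Setting. $\Omega=\Omega_{\boldsymbol x}\times\Omega_{\boldsymbol v}$ is a phase-space domain of dimension $d=d_x+d_v$, with periodic boundary conditions on $\Omega$, and $\nabla=(\nabla_{\boldsymbol x},\nabla_{\boldsymbol v})^{\mathsf T}$. One approximates $\partial_t f+\boldsymbol\beta\cdot\nabla f=0$, where $\boldsymbol\beta=(\boldsymbol v,\boldsymbol E+\boldsymbol v\times\boldsymbol B)^{\mathsf T}$ with $\boldsymbol E=\boldsymbol E(\boldsymbol x,t)$, $\boldsymbol B=\boldsymbol B(\boldsymbol x,t)$. At time $t^n$ the discrete velocity field is $\boldsymbol\beta_h^n=(\boldsymbol v,\boldsymbol E_h^n+\boldsymbol v\times\boldsymbol B_h^n)^{\mathsf T}$, where $\boldsymbol E_h^n,\boldsymbol B_h^n$ are given finite element fields depending on $\boldsymbol x$ only; it satisfies $\nabla\cdot\boldsymbol\beta_h^n\equiv0$. Finite element space. $\mathcal T_{\boldsymbol x}$ and $\mathcal T_{\boldsymbol v}$ are meshes of $\Omega_{\boldsymbol x}$ and $\Omega_{\boldsymbol v}$ made of cuboids; $\mathcal V_{\boldsymbol x}$ and $\mathcal V_{\boldsymbol v}$ are the spaces of continuous functions which on every cell are polynomials of degree at most one in each variable ($\mathbb Q_1$ elements), with nodal bases $\{\phi_i\}_{i=1}^{N_x}$ and $\{\varphi_j\}_{j=1}^{N_v}$. Then $\mathcal V_h=\mathcal V_{\boldsymbol x}\otimes\mathcal V_{\boldsymbol v}$, with nodal basis $\{\psi_i\}_{i=1}^N$, $N=N_xN_v$,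 $\psi_{(i-1)N_v+j}=\phi_i\varphi_j$. $\mathcal I(i)$ denotes the set of (indices of) all nodes within the support of $\psi_i$ (so $i\in\mathcal I(i)$). $(\cdot,\cdot)$ is the $L^2(\Omega)$ inner product. Coefficients. $m_{ij}=(\psi_j,\psi_i)$; lumped mass $m_i=\sum_{j\in\mathcal I(i)}m_{ij}$; $c_{ij}^n=(\boldsymbol\beta_h^n\cdot\nabla\psi_j,\psi_i)$; low-order viscosity $$d_{ij}^{\mathsf L,n}=\max\big(|c_{ij}^n|,|c_{ji}^n|\big)\ (j\ne i),\qquad d_{ii}^{\mathsf L,n}=-\sum_{j\in\mathcal I(i),\,j\ne i}d_{ij}^{\mathsf L,n}.$$ *)

theory Defs
  imports "HOL-Analysis.Analysis"
begin

text \<open>A conforming mesh of the box \<open>cbox a b\<close> by non-degenerate cuboids: any two cells meet in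
  a common face (possibly empty).\<close>

definition cuboid_mesh :: "'a::euclidean_space \<Rightarrow> 'a \<Rightarrow> 'a set set \<Rightarrow> bool" where
  "cuboid_mesh a b T \<longleftrightarrow>
     box a b \<noteq> {} \<and> T division_of cbox a b \<and>
     (\<forall>K\<in>T. interior K \<noteq> {}) \<and>
     (\<forall>K\<in>T. \<forall>L\<in>T. (K \<inter> L) face_of K \<and> (K \<inter> L) face_of L)"

text \<open>Periodic boundary conditions on \<open>cbox a b\<close> are encoded by working with the periodic
  extensions of the functions to the whole space.\<close>

definition periodic_on_box :: "'a::euclidean_space \<Rightarrow> 'a \<Rightarrow> ('a \<Rightarrow> real) \<Rightarrow> bool" where
  "periodic_on_box a b u \<longleftrightarrow> (\<forall>x. \<forall>k\<in>Basis. u (x + ((b - a) \<bullet> k) *\<^sub>R k) = u x)"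

definition Q1_poly_on :: "'a::euclidean_space set \<Rightarrow> ('a \<Rightarrow> real) \<Rightarrow> bool" where
  "Q1_poly_on K u \<longleftrightarrow> (\<exists>c. \<forall>x\<in>K. u x = (\<Sum>S\<in>Pow Basis. c S * (\<Prod>k\<in>S. x \<bullet> k)))"

definition Q1_space :: "'a::euclidean_space \<Rightarrow> 'a \<Rightarrow> 'a set set \<Rightarrow> ('a \<Rightarrow> real) set" where
  "Q1_space a b T =
     {u. continuous_on UNIV u \<and> periodic_on_box a b u \<and> (\<forall>K\<in>T. Q1_poly_on K u)}"

text \<open>The nodes are the vertices of the cells modulo the periods; each class is represented by its
  element in the half-open period box.\<close>

definition mesh_nodes :: "'a::euclidean_space \<Rightarrow> 'a \<Rightarrow> 'a set set \<Rightarrow> 'a set" where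
  "mesh_nodes a b T =
     {x. (\<forall>k\<in>Basis. a \<bullet> k \<le> x \<bullet> k \<and> x \<bullet> k < b \<bullet> k) \<and>
         (\<exists>K\<in>T. \<exists>p. p extreme_point_of K \<and>
            (\<forall>k\<in>Basis. \<exists>r::int. p \<bullet> k = x \<bullet> k + of_int r * ((b - a) \<bullet> k)))}"

definition nodal_basis ::
  "'a::euclidean_space \<Rightarrow> 'a \<Rightarrow> 'a set set \<Rightarrow> nat \<Rightarrow> (nat \<Rightarrow> 'a) \<Rightarrow> (nat \<Rightarrow> 'a \<Rightarrow> real) \<Rightarrow> bool" where
  "nodal_basis a b T N y \<phi> \<longleftrightarrow>
     bij_betw y {1..N} (mesh_nodes a b T) \<and>
     (\<forall>i\<in>{1..N}. \<phi> i \<in> Q1_space a b T) \<and>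
     (\<forall>i\<in>{1..N}. \<forall>j\<in>{1..N}. \<phi> i (y j) = (if i = j then 1 else 0))"

definition tensor_space ::
  "('a \<Rightarrow> real) set \<Rightarrow> ('b \<Rightarrow> real) set \<Rightarrow> ('a \<times> 'b \<Rightarrow> real) set" where
  "tensor_space U W =
     {\<lambda>(x, v). (\<Sum>l<r. p l x * q l v) | (r::nat) p q. \<forall>l<r. p l \<in> U \<and> q l \<in> W}"

definition l2_inner ::
  "'a::euclidean_space set \<Rightarrow> ('a \<Rightarrow> real) \<Rightarrow> ('a \<Rightarrow> real) \<Rightarrow> real" where
  "l2_inner S u w = (LINT z:S|lebesgue. u z * w z)"

text \<open>The classical gradient. It is unspecified at points of non-differentiability; for the
  piecewise polynomial functions used here these lie on cell boundaries, a Lebesgue null set, so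
  that it represents the weak gradient of continuous piecewise polynomials.\<close>

definition grad :: "('a::real_inner \<Rightarrow> real) \<Rightarrow> 'a \<Rightarrow> 'a" where
  "grad f z = (THE D. GDERIV f z :> D)"

text \<open>A finite element field is polynomial inside every cell; no continuity across cells is
  required, and the values on cell boundaries are irrelevant.\<close>

definition fe_field :: "'a::euclidean_space set set \<Rightarrow> ('a \<Rightarrow> 'b::euclidean_space) \<Rightarrow> bool" where
  "fe_field T F \<longleftrightarrow> (\<forall>K\<in>T. \<exists>p. polynomial_function p \<and> (\<forall>x\<in>interior K. F x = p x))"

text \<open>The velocity field \<open>(v, E + v \<times> B)\<close>. To make sense of the cross product for all phase-space
  dimensions, the fields take values in three-space and the injections \<open>\<iota>x\<close>, \<open>\<iota>v\<close> tell which
  Cartesian axes are resolved by the position and by the velocity variable; the unresolved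
  velocity components vanish. In the full three-dimensional case both are the identity. The field is
  divergence free by construction: \<open>E\<close> and \<open>B\<close> depend on \<open>x\<close> only, and a component of the cross
  product does not involve the same component of the velocity.\<close>

definition embed3 :: "('n::finite \<Rightarrow> 3) \<Rightarrow> real ^ 'n \<Rightarrow> real ^ 3" where
  "embed3 \<iota> v = (\<Sum>j\<in>UNIV. v $ j *\<^sub>R axis (\<iota> j) 1)"

definition vlasov_field ::
  "('m::finite \<Rightarrow> 3) \<Rightarrow> ('n::finite \<Rightarrow> 3) \<Rightarrow> (real ^ 'm \<Rightarrow> real ^ 3) \<Rightarrow> (real ^ 'm \<Rightarrow> real ^ 3) \<Rightarrow>
     (real ^ 'm) \<times> (real ^ 'n) \<Rightarrow> (real ^ 'm) \<times> (real ^ 'n)" where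
  "vlasov_field \<iota>x \<iota>v E B = (\<lambda>(x, v).
     (\<chi> i. embed3 \<iota>v v $ \<iota>x i,
      \<chi> j. (E x + cross3 (embed3 \<iota>v v) (B x)) $ \<iota>v j))"

text \<open>Indices of the nodes in the (closed) support of a basis function. Since the functions are
  periodically extended, the support contains all periodic images of the support on the torus.\<close>

definition stencil ::
  "nat \<Rightarrow> (nat \<Rightarrow> 'a::topological_space) \<Rightarrow> (nat \<Rightarrow> 'a \<Rightarrow> real) \<Rightarrow> nat \<Rightarrow> nat set" where
  "stencil N y \<psi> i = {j \<in> {1..N}. y j \<in> closure {z. \<psi> i z \<noteq> 0}}"

end

theory Submission
  imports Defs
begin

text \<open>
  Write \<open>D = (\<Sum>j\<in>I i - {i}. d i j)\<close>. If the \<open>i\<close>-th row of \<open>c\<close> sums to zero over the stencil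
  \<open>I i\<close>, the low-order update takes the form
  \<open>m i * fL i = (m i - \<tau> * W) * f i + \<tau> * (\<Sum>j\<in>I i - {i}. (d i j - c i j) * f j)\<close>,
  where \<open>W\<close> is the sum of the weights \<open>d i j - c i j\<close> over \<open>j \<in> I i - {i}\<close>.
  By definition of the viscosity
  \<open>0 \<le> d i j - c i j \<le> 2 * d i j\<close>, and \<open>2 * \<tau> * D \<le> m i\<close> by the CFL condition. As \<open>m i\<close> and
  \<open>\<tau>\<close> are positive, \<open>fL i\<close> is a convex combination of the values \<open>f j\<close> with \<open>j \<in> I i\<close>
  (\<open>low_order_update_bounds\<close>). What remains are three properties of the finite element matrices.

  Row sums over all indices vanish (\<open>advection_coefficients_sum_zero\<close>): the basis functions form
  a partition of unity, so that their gradients add up to zero inside every cell. Exchanging the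
  sum and the integral is legitimate because each integrand agrees on the interior of every cell
  with a function that is continuous on the closed cell.

  Entries outside the stencil vanish (\<open>advection_coefficient_zero\<close>): if the node of \<open>\<psi> j\<close> lies
  outside the closed support of \<open>\<psi> i\<close>, then on every cell one of the two functions is
  identically zero (\<open>tensor_basis_zero_on_cell\<close>).

  The lumped masses are positive: all basis functions are nonnegative on the domain, so that
  \<open>m i \<ge> M i i > 0\<close>.

  All this rests on two facts about a polynomial of degree at most one in each variable on a cuboid,
  obtained by moving one coordinate at a time: it is nonnegative if its vertex values are
  (\<open>Q1_nonneg_on_cuboid\<close>), and if it is nonnegative and vanishes at an interior point, it vanishes
  identically (\<open>Q1_zero_if_zero_inside\<close>). A finite element function is therefore determined by its
  nodal values, which gives the partition of unity, and a basis function is on each cell either zero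
  or strictly positive in the interior.
\<close>

section \<open>Multilinear polynomials on a cuboid\<close>

text \<open>The point \<open>x\<close> with its coordinate along the axis \<open>k\<close> replaced by \<open>t\<close>.\<close>

definition set_coord :: "'a::euclidean_space \<Rightarrow> real \<Rightarrow> 'a \<Rightarrow> 'a" where
  "set_coord k t x = x + (t - x \<bullet> k) *\<^sub>R k"

lemma set_coord_inner:
  assumes "k \<in> Basis" "l \<in> Basis"
  shows "set_coord k t x \<bullet> l = (if l = k then t else x \<bullet> l)"
  using assms by (auto simp: set_coord_def inner_simps inner_Basis)

lemma set_coord_self: "set_coord k (x \<bullet> k) x = x"
  by (simp add: set_coord_def)

lemma set_coord_in_cbox:
  assumes "x \<in> cbox p q" "k \<in> Basis" "p \<bullet> k \<le> t" "t \<le> q \<bullet> k"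
  shows "set_coord k t x \<in> cbox p q"
  using assms by (auto simp: mem_box set_coord_inner)

lemma Q1_affine_in_coord:
  fixes u :: "'a::euclidean_space \<Rightarrow> real"
  assumes u: "Q1_poly_on (cbox p q) u" and x: "x \<in> cbox p q" and k: "k \<in> Basis"
  obtains A B where "\<And>t. p \<bullet> k \<le> t \<Longrightarrow> t \<le> q \<bullet> k \<Longrightarrow> u (set_coord k t x) = A + B * t"
proof -
  obtain c where c: "\<And>y. y \<in> cbox p q \<Longrightarrow> u y = (\<Sum>S\<in>Pow Basis. c S * (\<Prod>l\<in>S. y \<bullet> l))"
    using u unfolding Q1_poly_on_def by blast
  define A where "A = (\<Sum>S\<in>Pow Basis. if k \<in> S then 0 else c S * (\<Prod>l\<in>S. x \<bullet> l))"
  define B where "B = (\<Sum>S\<in>Pow Basis. if k \<in> S then c S * (\<Prod>l\<in>S - {k}. x \<bullet> l) else 0)"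
  have "u (set_coord k t x) = A + B * t" if t: "p \<bullet> k \<le> t" "t \<le> q \<bullet> k" for t
  proof -
    have term_eq: "c S * (\<Prod>l\<in>S. set_coord k t x \<bullet> l) =
        (if k \<in> S then 0 else c S * (\<Prod>l\<in>S. x \<bullet> l)) +
        (if k \<in> S then c S * (\<Prod>l\<in>S - {k}. x \<bullet> l) else 0) * t"
      if S: "S \<in> Pow Basis" for S
    proof -
      have fin: "finite S" using S finite_Basis by (meson PowD finite_subset)
      have cong: "(\<Prod>l\<in>S - {k}. set_coord k t x \<bullet> l) = (\<Prod>l\<in>S - {k}. x \<bullet> l)"
        using S k by (intro prod.cong) (auto simp: set_coord_inner subset_iff)
      show ?thesis
      proof (cases "k \<in> S")
        case True
        then show ?thesis
          using cong k by (simp add: prod.remove[OF fin True] set_coord_inner)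
      next
        case False
        then show ?thesis using cong by simp
      qed
    qed
    have "u (set_coord k t x) = (\<Sum>S\<in>Pow Basis. c S * (\<Prod>l\<in>S. set_coord k t x \<bullet> l))"
      using c set_coord_in_cbox[OF x k t] by blast
    also have "\<dots> = A + B * t"
      unfolding A_def B_def sum_distrib_right sum.distrib[symmetric]
      by (rule sum.cong[OF refl term_eq])
    finally show ?thesis .
  qed
  with that show thesis by blast
qed

lemma affine_nonneg_between:
  fixes A B :: real
  assumes "0 \<le> A + B * p" "0 \<le> A + B * q" "p \<le> t" "t \<le> q"
  shows "0 \<le> A + B * t"
proof (cases "0 \<le> B")
  case True
  then have "B * p \<le> B * t" using assms(3) by (rule mult_left_mono[rotated])
  then show ?thesis using assms(1) by linarith
next
  case False
  then have "B * q \<le> B * t" using assms(4) by (intro mult_left_mono_neg) auto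
  then show ?thesis using assms(2) by linarith
qed

lemma Q1_nonneg_on_cuboid:
  fixes u :: "'a::euclidean_space \<Rightarrow> real"
  assumes u: "Q1_poly_on (cbox p q) u"
    and vert: "\<And>z. z \<in> cbox p q \<Longrightarrow> \<forall>k\<in>Basis. z \<bullet> k = p \<bullet> k \<or> z \<bullet> k = q \<bullet> k \<Longrightarrow> 0 \<le> u z"
    and x: "x \<in> cbox p q"
  shows "0 \<le> u x"
proof -
  \<comment> \<open>Induction on the set \<open>F\<close> of coordinates that may lie strictly between the end points.\<close>
  have "0 \<le> u x"
    if "finite F" "F \<subseteq> Basis" "x \<in> cbox p q" "\<forall>k\<in>Basis - F. x \<bullet> k = p \<bullet> k \<or> x \<bullet> k = q \<bullet> k" for F x
    using that
  proof (induction F arbitrary: x rule: finite_induct)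
    case empty
    then show ?case using vert by auto
  next
    case (insert k F)
    then have k: "k \<in> Basis" by auto
    have pq: "p \<bullet> k \<le> x \<bullet> k" "x \<bullet> k \<le> q \<bullet> k" using insert.prems(2) k by (auto simp: mem_box)
    obtain A B where AB: "\<And>t. p \<bullet> k \<le> t \<Longrightarrow> t \<le> q \<bullet> k \<Longrightarrow> u (set_coord k t x) = A + B * t"
      using Q1_affine_in_coord[OF u insert.prems(2) k] by blast
    have ends: "0 \<le> A + B * t" if t: "t = p \<bullet> k \<or> t = q \<bullet> k" for t
    proof -
      have t': "p \<bullet> k \<le> t" "t \<le> q \<bullet> k" using t pq by auto
      have "0 \<le> u (set_coord k t x)"
      proof (rule insert.IH)
        show "F \<subseteq> Basis" using insert.prems by auto
        show "set_coord k t x \<in> cbox p q" by (rule set_coord_in_cbox[OF insert.prems(2) k t'])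
        show "\<forall>l\<in>Basis - F. set_coord k t x \<bullet> l = p \<bullet> l \<or> set_coord k t x \<bullet> l = q \<bullet> l"
          using insert.prems(3) t k by (auto simp: set_coord_inner)
      qed
      then show ?thesis using AB[OF t'] by simp
    qed
    have "0 \<le> A + B * (x \<bullet> k)"
      using affine_nonneg_between[OF ends ends pq] by simp
    then show ?case using AB[OF pq] by (simp add: set_coord_self)
  qed
  from this[OF finite_Basis] x show ?thesis by simp
qed

text \<open>Strong minimum principle: a nonnegative multilinear polynomial that vanishes at an interior
  point of the cuboid vanishes on each coordinate line through that point, hence everywhere.\<close>

lemma Q1_zero_if_zero_inside:
  fixes u :: "'a::euclidean_space \<Rightarrow> real"
  assumes u: "Q1_poly_on (cbox p q) u"
    and nonneg: "\<And>z. z \<in> cbox p q \<Longrightarrow> 0 \<le> u z"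
    and x: "x \<in> box p q" "u x = 0" and z: "z \<in> cbox p q"
  shows "u z = 0"
proof -
  \<comment> \<open>Replace the coordinates of \<open>x\<close> by those of \<open>z\<close>; the ones still to be replaced stay strictly
    between the end points.\<close>
  define w where "w F = (\<Sum>k\<in>Basis. (if k \<in> F then z \<bullet> k else x \<bullet> k) *\<^sub>R k)" for F
  have w_inner: "w F \<bullet> k = (if k \<in> F then z \<bullet> k else x \<bullet> k)" if "k \<in> Basis" for F k
    using that unfolding w_def by (rule inner_sum_left_Basis)
  have w_in: "w F \<in> cbox p q" for F
    using x(1) z by (simp add: mem_box w_inner less_imp_le)
  have "u (w F) = 0" if "finite F" "F \<subseteq> Basis" for F
    using that
  proof (induction F rule: finite_induct)
    case empty
    have "w {} = x" by (rule euclidean_eqI) (simp add: w_inner)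
    then show ?case using x by simp
  next
    case (insert k F)
    then have k: "k \<in> Basis" and IH: "u (w F) = 0" by auto
    obtain A B where
      AB: "\<And>t. p \<bullet> k \<le> t \<Longrightarrow> t \<le> q \<bullet> k \<Longrightarrow> u (set_coord k t (w F)) = A + B * t"
      using Q1_affine_in_coord[OF u w_in k] by blast
    have xk: "p \<bullet> k < x \<bullet> k" "x \<bullet> k < q \<bullet> k" and zk: "p \<bullet> k \<le> z \<bullet> k" "z \<bullet> k \<le> q \<bullet> k"
      using x(1) z k by (auto simp: mem_box)
    have nn: "0 \<le> A + B * t" if "p \<bullet> k \<le> t" "t \<le> q \<bullet> k" for t
      using AB[OF that] nonneg[OF set_coord_in_cbox[OF w_in[of F] k that]] by simp
    have "set_coord k (x \<bullet> k) (w F) = w F"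
      using set_coord_self[of k "w F"] w_inner[OF k, of F] insert.hyps by simp
    then have zero: "A + B * (x \<bullet> k) = 0"
      using AB[of "x \<bullet> k"] xk IH by simp
    \<comment> \<open>An affine function that is nonnegative on an interval and vanishes inside it is constant.\<close>
    have "0 \<le> B * (p \<bullet> k - x \<bullet> k)" "0 \<le> B * (q \<bullet> k - x \<bullet> k)"
      using nn[of "p \<bullet> k"] nn[of "q \<bullet> k"] xk zero unfolding right_diff_distrib by linarith+
    then have "B \<le> 0" "0 \<le> B"
      using xk by (simp_all add: zero_le_mult_iff)
    then have "B = 0" by simp
    moreover have "w (insert k F) = set_coord k (z \<bullet> k) (w F)"
      by (rule euclidean_eqI) (simp add: w_inner set_coord_inner[OF k])
    ultimately show ?case
      using AB[OF zk] zero by simp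
  qed
  from this[OF finite_Basis] have "u (w Basis) = 0" by simp
  moreover have "w Basis = z" by (rule euclidean_eqI) (simp add: w_inner)
  ultimately show ?thesis by simp
qed

lemma vertex_extreme_point_of_cbox:
  assumes z: "z \<in> cbox p q" and vert: "\<forall>k\<in>Basis. z \<bullet> k = p \<bullet> k \<or> z \<bullet> k = q \<bullet> k"
  shows "z extreme_point_of cbox p q"
  unfolding extreme_point_of_def
proof (intro conjI ballI z notI)
  fix a b assume a: "a \<in> cbox p q" and b: "b \<in> cbox p q" and "z \<in> open_segment a b"
  then obtain s where s: "0 < s" "s < 1" "a \<noteq> b" and zs: "z = (1 - s) *\<^sub>R a + s *\<^sub>R b"
    by (auto simp: in_segment)
  have "a \<bullet> k = b \<bullet> k" if k: "k \<in> Basis" for k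
  proof -
    have bounds: "p \<bullet> k \<le> a \<bullet> k" "a \<bullet> k \<le> q \<bullet> k" "p \<bullet> k \<le> b \<bullet> k" "b \<bullet> k \<le> q \<bullet> k"
      using a b k by (auto simp: mem_box)
    have zk: "z \<bullet> k = (1 - s) * (a \<bullet> k) + s * (b \<bullet> k)" by (simp add: zs inner_simps)
    from vert k consider "z \<bullet> k = p \<bullet> k" | "z \<bullet> k = q \<bullet> k" by blast
    then show ?thesis
    proof cases
      case 1
      then have "(1 - s) * (a \<bullet> k - p \<bullet> k) + s * (b \<bullet> k - p \<bullet> k) = 0"
        using zk by (simp add: algebra_simps)
      moreover have "0 \<le> (1 - s) * (a \<bullet> k - p \<bullet> k)" "0 \<le> s * (b \<bullet> k - p \<bullet> k)"
        using bounds s by auto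
      ultimately have "(1 - s) * (a \<bullet> k - p \<bullet> k) = 0" "s * (b \<bullet> k - p \<bullet> k) = 0" by linarith+
      then show ?thesis using s by simp
    next
      case 2
      then have "(1 - s) * (q \<bullet> k - a \<bullet> k) + s * (q \<bullet> k - b \<bullet> k) = 0"
        using zk by (simp add: algebra_simps)
      moreover have "0 \<le> (1 - s) * (q \<bullet> k - a \<bullet> k)" "0 \<le> s * (q \<bullet> k - b \<bullet> k)"
        using bounds s by auto
      ultimately have "(1 - s) * (q \<bullet> k - a \<bullet> k) = 0" "s * (q \<bullet> k - b \<bullet> k) = 0" by linarith+
      then show ?thesis using s by simp
    qed
  qed
  then have "a = b" by (rule euclidean_eqI)
  then show False using s(3) by simp
qed

section \<open>Nodal bases on a periodic mesh\<close>

lemma periodic_on_box_congruent: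
  fixes u :: "'a::euclidean_space \<Rightarrow> real"
  assumes per: "periodic_on_box a b u"
    and cong: "\<forall>k\<in>Basis. \<exists>r::int. p \<bullet> k = x \<bullet> k + of_int r * ((b - a) \<bullet> k)"
  shows "u p = u x"
proof -
  have one: "u (x + ((b - a) \<bullet> k) *\<^sub>R k) = u x" if "k \<in> Basis" for x k
    using per that unfolding periodic_on_box_def by blast
  have nat_mult: "u (x + (of_nat n * ((b - a) \<bullet> k)) *\<^sub>R k) = u x" if k: "k \<in> Basis" for n x k
  proof (induction n)
    case (Suc n)
    have "x + (of_nat (Suc n) * ((b - a) \<bullet> k)) *\<^sub>R k =
        (x + (of_nat n * ((b - a) \<bullet> k)) *\<^sub>R k) + ((b - a) \<bullet> k) *\<^sub>R k"
      by (simp add: algebra_simps)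
    then show ?case using one[OF k] Suc by metis
  qed simp
  have int_mult: "u (x + (of_int r * ((b - a) \<bullet> k)) *\<^sub>R k) = u x" if k: "k \<in> Basis" for r x k
  proof (cases "0 \<le> r")
    case True
    then obtain n where "r = int n" using nonneg_int_cases by blast
    then show ?thesis using nat_mult[OF k, of x n] by simp
  next
    case False
    then obtain n where n: "r = - int n" by (metis int_cases2 of_nat_0_le_iff)
    show ?thesis
      using nat_mult[OF k, of "x + (of_int r * ((b - a) \<bullet> k)) *\<^sub>R k" n] by (simp add: n)
  qed
  obtain r :: "'a \<Rightarrow> int" where
    r: "\<And>k. k \<in> Basis \<Longrightarrow> p \<bullet> k = x \<bullet> k + of_int (r k) * ((b - a) \<bullet> k)"
    using bchoice[OF cong] by blast
  have "u (x + (\<Sum>k\<in>F. (of_int (r k) * ((b - a) \<bullet> k)) *\<^sub>R k)) = u x"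
    if "finite F" "F \<subseteq> Basis" for F
    using that
  proof (induction F rule: finite_induct)
    case (insert k F)
    then have k: "k \<in> Basis" by auto
    have eq: "x + (\<Sum>k\<in>insert k F. (of_int (r k) * ((b - a) \<bullet> k)) *\<^sub>R k) =
       (x + (\<Sum>k\<in>F. (of_int (r k) * ((b - a) \<bullet> k)) *\<^sub>R k)) + (of_int (r k) * ((b - a) \<bullet> k)) *\<^sub>R k"
      using insert.hyps by (simp add: algebra_simps)
    show ?case
      unfolding eq int_mult[OF k] using insert.IH insert.prems by simp
  qed simp
  from this[OF finite_Basis]
  have "u (x + (\<Sum>k\<in>Basis. (of_int (r k) * ((b - a) \<bullet> k)) *\<^sub>R k)) = u x" by simp
  moreover have "x + (\<Sum>k\<in>Basis. (of_int (r k) * ((b - a) \<bullet> k)) *\<^sub>R k) = p"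
    by (rule euclidean_eqI) (simp add: r inner_add_left)
  ultimately show ?thesis by simp
qed

lemma cuboid_mesh_cellE:
  assumes "cuboid_mesh a b T" "K \<in> T"
  obtains p q where "K = cbox p q" "interior K = box p q" "box p q \<noteq> {}" "K \<subseteq> cbox a b"
proof -
  have div: "T division_of cbox a b" and "interior K \<noteq> {}"
    using assms by (auto simp: cuboid_mesh_def)
  moreover obtain p q where "K = cbox p q" using division_ofD(4)[OF div assms(2)] by blast
  ultimately show thesis
    using that division_ofD(2)[OF div assms(2)] by (auto simp: interior_cbox)
qed

lemma cuboid_mesh_Union: "cuboid_mesh a b T \<Longrightarrow> \<Union>T = cbox a b"
  by (simp add: cuboid_mesh_def division_of_def)

text \<open>Every vertex of a cell is a period translate of a node. This reduces vertex values of periodic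
  functions to nodal values.\<close>

lemma cell_vertex_congruent_node:
  assumes mesh: "cuboid_mesh a b T" and K: "K \<in> T" "K = cbox p q"
    and z: "z \<in> K" "\<forall>k\<in>Basis. z \<bullet> k = p \<bullet> k \<or> z \<bullet> k = q \<bullet> k"
  obtains x where "x \<in> mesh_nodes a b T"
    "\<forall>k\<in>Basis. \<exists>r::int. z \<bullet> k = x \<bullet> k + of_int r * ((b - a) \<bullet> k)"
proof -
  have ab: "a \<bullet> k < b \<bullet> k" if "k \<in> Basis" for k
    using mesh that by (auto simp: cuboid_mesh_def box_ne_empty)
  have "z \<in> cbox a b" using cuboid_mesh_cellE[OF mesh K(1)] z(1) by blast
  then have zk: "a \<bullet> k \<le> z \<bullet> k" "z \<bullet> k \<le> b \<bullet> k" if "k \<in> Basis" for k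
    using that by (auto simp: mem_box)
  \<comment> \<open>Wrap the coordinates on the upper faces of the period box around to the lower ones.\<close>
  define x where "x = (\<Sum>k\<in>Basis. (if z \<bullet> k = b \<bullet> k then a \<bullet> k else z \<bullet> k) *\<^sub>R k)"
  have xk: "x \<bullet> k = (if z \<bullet> k = b \<bullet> k then a \<bullet> k else z \<bullet> k)" if "k \<in> Basis" for k
    using that by (simp add: x_def)
  have cong: "\<forall>k\<in>Basis. \<exists>r::int. z \<bullet> k = x \<bullet> k + of_int r * ((b - a) \<bullet> k)"
  proof
    fix k :: 'a assume k: "k \<in> Basis"
    show "\<exists>r::int. z \<bullet> k = x \<bullet> k + of_int r * ((b - a) \<bullet> k)"
      by (rule exI[of _ "if z \<bullet> k = b \<bullet> k then 1 else 0"]) (simp add: xk[OF k] inner_diff_left)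
  qed
  have "z extreme_point_of K"
    using vertex_extreme_point_of_cbox[of z p q] z K by simp
  moreover have "\<forall>k\<in>Basis. a \<bullet> k \<le> x \<bullet> k \<and> x \<bullet> k < b \<bullet> k"
    using xk zk ab by (simp add: order.strict_iff_order)
  ultimately have "x \<in> mesh_nodes a b T"
    using cong K(1) unfolding mesh_nodes_def by blast
  then show thesis using that cong by blast
qed

lemma Q1_space_nonneg:
  assumes mesh: "cuboid_mesh a b T" and u: "u \<in> Q1_space a b T"
    and nodes: "\<And>x. x \<in> mesh_nodes a b T \<Longrightarrow> 0 \<le> u x" and z: "z \<in> cbox a b"
  shows "0 \<le> u z"
proof -
  have "z \<in> \<Union>T" using z by (simp add: cuboid_mesh_Union[OF mesh])
  then obtain K where K: "K \<in> T" "z \<in> K" by blast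
  obtain p q where pq: "K = cbox p q" by (rule cuboid_mesh_cellE[OF mesh K(1)])
  have per: "periodic_on_box a b u" and Q1: "Q1_poly_on (cbox p q) u"
    using u K(1) unfolding Q1_space_def pq by auto
  show ?thesis
  proof (rule Q1_nonneg_on_cuboid[OF Q1])
    show "z \<in> cbox p q" using K pq by simp
    fix w assume w: "w \<in> cbox p q" "\<forall>k\<in>Basis. w \<bullet> k = p \<bullet> k \<or> w \<bullet> k = q \<bullet> k"
    have "w \<in> K" using w(1) pq by simp
    from cell_vertex_congruent_node[OF mesh K(1) pq this w(2)]
    obtain x where x: "x \<in> mesh_nodes a b T"
      "\<forall>k\<in>Basis. \<exists>r::int. w \<bullet> k = x \<bullet> k + of_int r * ((b - a) \<bullet> k)"
      by blast
    show "0 \<le> u w" using nodes[OF x(1)] periodic_on_box_congruent[OF per x(2)] by simp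
  qed
qed

lemma Q1_space_affine_combination:
  fixes \<phi> :: "'i \<Rightarrow> 'a::euclidean_space \<Rightarrow> real"
  assumes mem: "\<And>i. i \<in> A \<Longrightarrow> \<phi> i \<in> Q1_space a b T"
  shows "(\<lambda>x. s0 + (\<Sum>i\<in>A. s i * \<phi> i x)) \<in> Q1_space a b T"
proof -
  have "continuous_on UNIV (\<lambda>x. s0 + (\<Sum>i\<in>A. s i * \<phi> i x))"
    using mem by (intro continuous_intros) (auto simp: Q1_space_def)
  moreover have "periodic_on_box a b (\<lambda>x. s0 + (\<Sum>i\<in>A. s i * \<phi> i x))"
    using mem by (simp add: Q1_space_def periodic_on_box_def)
  moreover have "Q1_poly_on K (\<lambda>x. s0 + (\<Sum>i\<in>A. s i * \<phi> i x))" if "K \<in> T" for K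
  proof -
    have "\<forall>i\<in>A. \<exists>c. \<forall>x\<in>K. \<phi> i x = (\<Sum>S\<in>Pow Basis. c S * (\<Prod>k\<in>S. x \<bullet> k))"
      using mem that by (auto simp: Q1_space_def Q1_poly_on_def)
    from bchoice[OF this] obtain C where C: "\<And>i x. i \<in> A \<Longrightarrow> x \<in> K \<Longrightarrow>
        \<phi> i x = (\<Sum>S\<in>Pow Basis. C i S * (\<Prod>k\<in>S. x \<bullet> k))"
      by blast
    define D where "D S = (if S = {} then s0 else 0) + (\<Sum>i\<in>A. s i * C i S)" for S
    have "s0 + (\<Sum>i\<in>A. s i * \<phi> i x) = (\<Sum>S\<in>Pow Basis. D S * (\<Prod>k\<in>S. x \<bullet> k))"
      if x: "x \<in> K" for x
    proof -
      have "(\<Sum>S\<in>Pow Basis. D S * (\<Prod>k\<in>S. x \<bullet> k)) =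
          (\<Sum>S\<in>Pow (Basis :: 'a set). if S = {} then s0 else 0) +
          (\<Sum>S\<in>Pow Basis. \<Sum>i\<in>A. s i * (C i S * (\<Prod>k\<in>S. x \<bullet> k)))"
        unfolding sum.distrib[symmetric]
        by (rule sum.cong) (simp_all add: D_def distrib_right sum_distrib_right mult.assoc)
      also have "(\<Sum>S\<in>Pow (Basis :: 'a set). if S = {} then s0 else 0) = s0"
        by (simp add: sum.delta)
      also have "(\<Sum>S\<in>Pow Basis. \<Sum>i\<in>A. s i * (C i S * (\<Prod>k\<in>S. x \<bullet> k))) = (\<Sum>i\<in>A. s i * \<phi> i x)"
        by (subst sum.swap) (simp add: C x sum_distrib_left)
      finally show ?thesis by simp
    qed
    then show ?thesis unfolding Q1_poly_on_def by blast
  qed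
  ultimately show ?thesis by (simp add: Q1_space_def)
qed

lemma nodal_basis_nodeE:
  assumes "nodal_basis a b T N y \<phi>" "x \<in> mesh_nodes a b T"
  obtains j where "j \<in> {1..N}" "x = y j"
proof -
  have "x \<in> y ` {1..N}" using assms by (simp add: nodal_basis_def bij_betw_def)
  then show thesis using that by blast
qed

lemma nodal_basis_nonneg:
  assumes "cuboid_mesh a b T" "nodal_basis a b T N y \<phi>" "i \<in> {1..N}" "z \<in> cbox a b"
  shows "0 \<le> \<phi> i z"
proof (rule Q1_space_nonneg[OF assms(1) _ _ assms(4)])
  show "\<phi> i \<in> Q1_space a b T" using assms by (auto simp: nodal_basis_def)
  fix x assume "x \<in> mesh_nodes a b T"
  then obtain j where "j \<in> {1..N}" "x = y j"
    using nodal_basis_nodeE[OF assms(2)] by blast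
  then show "0 \<le> \<phi> i x" using assms(2,3) by (simp add: nodal_basis_def)
qed

lemma nodal_basis_partition_of_unity:
  assumes mesh: "cuboid_mesh a b T" and nb: "nodal_basis a b T N y \<phi>" and z: "z \<in> cbox a b"
  shows "(\<Sum>i=1..N. \<phi> i z) = 1"
proof -
  have mem: "\<phi> i \<in> Q1_space a b T" if "i \<in> {1..N}" for i
    using nb that by (auto simp: nodal_basis_def)
  have node: "(\<Sum>i=1..N. \<phi> i x) = 1" if x: "x \<in> mesh_nodes a b T" for x
  proof -
    obtain j where "j \<in> {1..N}" "x = y j"
      using nodal_basis_nodeE[OF nb x] by blast
    then have "(\<Sum>i=1..N. \<phi> i x) = (\<Sum>i=1..N. if i = j then 1 else 0)"
      using nb by (intro sum.cong) (auto simp: nodal_basis_def)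
    then show ?thesis using \<open>j \<in> {1..N}\<close> by simp
  qed
  have "0 \<le> s0 + (\<Sum>i=1..N. s * \<phi> i z)" if "s0 + s = 0" for s0 s :: real
  proof (rule Q1_space_nonneg[OF mesh _ _ z])
    show "(\<lambda>x. s0 + (\<Sum>i=1..N. s * \<phi> i x)) \<in> Q1_space a b T"
      by (rule Q1_space_affine_combination[OF mem])
    show "0 \<le> s0 + (\<Sum>i=1..N. s * \<phi> i x)" if "x \<in> mesh_nodes a b T" for x
      using node[OF that] \<open>s0 + s = 0\<close> by (simp flip: sum_distrib_left)
  qed
  \<comment> \<open>Both \<open>(\<Sum>i. \<phi> i) - 1\<close> and \<open>1 - (\<Sum>i. \<phi> i)\<close> vanish at the nodes, hence are nonnegative.\<close>
  from this[of "-1" 1] this[of 1 "-1"] show ?thesis by (simp add: sum_negf)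
qed

lemma closed_support_congruent:
  fixes u :: "'a::euclidean_space \<Rightarrow> real"
  assumes per: "periodic_on_box a b u"
    and cong: "\<forall>k\<in>Basis. \<exists>r::int. p \<bullet> k = x \<bullet> k + of_int r * ((b - a) \<bullet> k)"
    and p: "p \<in> closure {z. u z \<noteq> 0}"
  shows "x \<in> closure {z. u z \<noteq> 0}"
proof -
  have "u ((x - p) + z) = u z" for z
  proof -
    have "\<forall>k\<in>Basis. \<exists>r::int. z \<bullet> k = ((x - p) + z) \<bullet> k + of_int r * ((b - a) \<bullet> k)"
    proof
      fix k :: 'a assume "k \<in> Basis"
      then obtain r :: int where "p \<bullet> k = x \<bullet> k + of_int r * ((b - a) \<bullet> k)"
        using cong by blast
      then have "z \<bullet> k = ((x - p) + z) \<bullet> k + of_int r * ((b - a) \<bullet> k)"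
        by (simp add: inner_add_left inner_diff_left)
      then show "\<exists>r::int. z \<bullet> k = ((x - p) + z) \<bullet> k + of_int r * ((b - a) \<bullet> k)" ..
    qed
    then show ?thesis using periodic_on_box_congruent[OF per] by metis
  qed
  then have "(+) (x - p) ` {z. u z \<noteq> 0} \<subseteq> {z. u z \<noteq> 0}" by auto
  then have "(+) (x - p) ` closure {z. u z \<noteq> 0} \<subseteq> closure {z. u z \<noteq> 0}"
    unfolding closure_translation[symmetric] by (rule closure_mono)
  then have "(x - p) + p \<in> closure {z. u z \<noteq> 0}" using p by blast
  then show ?thesis by simp
qed

text \<open>If \<open>\<phi> i\<close> and \<open>\<phi> j\<close> are both nontrivial on a cell \<open>K\<close>, then some vertex of \<open>K\<close> is a translate
  of the node \<open>y j\<close>, and \<open>\<phi> i\<close> is nonzero in the interior of \<open>K\<close>; so \<open>y j\<close> lies in the closed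
  support of \<open>\<phi> i\<close>.\<close>

lemma nodal_basis_zero_on_cell:
  assumes mesh: "cuboid_mesh a b T" and nb: "nodal_basis a b T N y \<phi>"
    and i: "i \<in> {1..N}" and j: "j \<in> {1..N}" and K: "K \<in> T"
    and out: "y j \<notin> closure {z. \<phi> i z \<noteq> 0}"
  shows "(\<forall>z\<in>K. \<phi> i z = 0) \<or> (\<forall>z\<in>K. \<phi> j z = 0)"
proof (rule ccontr)
  assume contra: "\<not> ?thesis"
  obtain p q where pq: "K = cbox p q" "interior K = box p q" "box p q \<noteq> {}" "K \<subseteq> cbox a b"
    by (rule cuboid_mesh_cellE[OF mesh K])
  have Q1: "Q1_poly_on (cbox p q) (\<phi> l)" and per: "periodic_on_box a b (\<phi> l)"
    if "l \<in> {1..N}" for l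
    using nb that K pq by (auto simp: nodal_basis_def Q1_space_def)
  have "\<exists>w\<in>cbox p q. (\<forall>k\<in>Basis. w \<bullet> k = p \<bullet> k \<or> w \<bullet> k = q \<bullet> k) \<and> \<phi> j w \<noteq> 0"
  proof (rule ccontr)
    assume none: "\<not> ?thesis"
    have "(\<lambda>x. - \<phi> j x) \<in> Q1_space a b T"
      using Q1_space_affine_combination[of "{j}" \<phi> a b T 0 "\<lambda>_. -1"] nb j
      by (simp add: nodal_basis_def)
    then have neg: "Q1_poly_on (cbox p q) (\<lambda>x. - \<phi> j x)"
      using K pq by (simp add: Q1_space_def)
    have "\<phi> j z = 0" if "z \<in> K" for z
    proof (rule order_antisym)
      have z: "z \<in> cbox p q" using that pq by simp
      have "0 \<le> - \<phi> j z" using none by (intro Q1_nonneg_on_cuboid[OF neg _ z]) auto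
      then show "\<phi> j z \<le> 0" by simp
      show "0 \<le> \<phi> j z" using none by (intro Q1_nonneg_on_cuboid[OF Q1[OF j] _ z]) auto
    qed
    then show False using contra by blast
  qed
  then obtain w where w: "w \<in> K" "\<forall>k\<in>Basis. w \<bullet> k = p \<bullet> k \<or> w \<bullet> k = q \<bullet> k" "\<phi> j w \<noteq> 0"
    using pq by blast
  obtain x where x: "x \<in> mesh_nodes a b T"
    "\<forall>k\<in>Basis. \<exists>r::int. w \<bullet> k = x \<bullet> k + of_int r * ((b - a) \<bullet> k)"
    using cell_vertex_congruent_node[OF mesh K pq(1) w(1,2)] by blast
  have "\<phi> j x \<noteq> 0" using periodic_on_box_congruent[OF per[OF j] x(2)] w(3) by simp
  moreover obtain l where "l \<in> {1..N}" "x = y l"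
    using nodal_basis_nodeE[OF nb x(1)] by blast
  ultimately have xj: "x = y j"
    using nb j by (auto simp: nodal_basis_def split: if_splits)
  have "\<phi> i z \<noteq> 0" if z: "z \<in> box p q" for z
  proof
    assume "\<phi> i z = 0"
    then have "\<phi> i z' = 0" if "z' \<in> K" for z'
      using Q1_zero_if_zero_inside[OF Q1[OF i] _ z] nodal_basis_nonneg[OF mesh nb i] that pq
      by blast
    then show False using contra by blast
  qed
  then have "closure (interior K) \<subseteq> closure {z. \<phi> i z \<noteq> 0}"
    unfolding pq(2) by (intro closure_mono) auto
  moreover have "K \<subseteq> closure (interior K)"
    using pq closure_subset convex_closure_interior[of K] by (metis convex_box(1))
  ultimately have "w \<in> closure {z. \<phi> i z \<noteq> 0}" using w(1) by blast
  then show False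
    using closed_support_congruent[OF per[OF i] x(2)] xj out by simp
qed

section \<open>Tensor product bases\<close>

lemma tensor_index_decompose:
  fixes Nx Nv k :: nat
  assumes "k \<in> {1..Nx * Nv}"
  obtains i j where "i \<in> {1..Nx}" "j \<in> {1..Nv}" "k = (i - 1) * Nv + j"
proof
  have Nv: "0 < Nv" using assms by (cases Nv) auto
  have "(k - 1) div Nv < Nx"
    using assms by (intro less_mult_imp_div_less) auto
  then show "(k - 1) div Nv + 1 \<in> {1..Nx}" by simp
  show "(k - 1) mod Nv + 1 \<in> {1..Nv}" using Nv by (simp add: Suc_leI)
  have "k - 1 = (k - 1) div Nv * Nv + (k - 1) mod Nv" by simp
  then show "k = ((k - 1) div Nv + 1 - 1) * Nv + ((k - 1) mod Nv + 1)"
    using assms by simp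
qed

lemma sum_tensor_index:
  fixes F :: "nat \<Rightarrow> real"
  shows "(\<Sum>k=1..Nx * Nv. F k) = (\<Sum>i=1..Nx. \<Sum>j=1..Nv. F ((i - 1) * Nv + j))"
proof (induction Nx)
  case (Suc n)
  have "(\<Sum>k=1..Suc n * Nv. F k) = (\<Sum>k=1..n * Nv. F k) + (\<Sum>k=n * Nv + 1..n * Nv + Nv. F k)"
    by (subst sum.ub_add_nat[symmetric]) (auto simp: add.commute)
  also have "(\<Sum>k=n * Nv + 1..n * Nv + Nv. F k) = (\<Sum>j=1..Nv. F (n * Nv + j))"
    using sum.shift_bounds_cl_nat_ivl[of F 1 "n * Nv" Nv] by (simp add: add.commute)
  finally show ?case using Suc by simp
qed simp

lemma mesh_nodes_subset: "mesh_nodes a b T \<subseteq> cbox a b"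
  by (auto simp: mesh_nodes_def mem_box less_imp_le)

text \<open>On every cell of the product mesh, either \<open>\<phi> i \<otimes> \<theta> j\<close> vanishes, or every tensor product
  basis function whose node lies outside its closed support does.\<close>

lemma tensor_basis_zero_on_cell:
  assumes mesh: "cuboid_mesh ax bx Tx" "cuboid_mesh av bv Tv"
    and nb: "nodal_basis ax bx Tx Nx yx \<phi>" "nodal_basis av bv Tv Nv yv \<theta>"
    and i: "i \<in> {1..Nx}" "i' \<in> {1..Nx}" and j: "j \<in> {1..Nv}" "j' \<in> {1..Nv}"
    and K: "K \<in> Tx" and L: "L \<in> Tv"
    and out: "(yx i', yv j') \<notin> closure {z. (\<lambda>(x, v). \<phi> i x * \<theta> j v) z \<noteq> 0}"
  shows "(\<forall>z\<in>K \<times> L. (\<lambda>(x, v). \<phi> i x * \<theta> j v) z = 0) \<or>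
         (\<forall>z\<in>K \<times> L. (\<lambda>(x, v). \<phi> i' x * \<theta> j' v) z = 0)"
proof -
  have supp: "{z. (\<lambda>(x, v). \<phi> i x * \<theta> j v) z \<noteq> 0} = {x. \<phi> i x \<noteq> 0} \<times> {v. \<theta> j v \<noteq> 0}"
    by auto
  from out consider "yx i' \<notin> closure {x. \<phi> i x \<noteq> 0}" | "yv j' \<notin> closure {v. \<theta> j v \<noteq> 0}"
    unfolding supp closure_Times by blast
  then show ?thesis
  proof cases
    case 1
    from nodal_basis_zero_on_cell[OF mesh(1) nb(1) i K this] show ?thesis by auto
  next
    case 2
    from nodal_basis_zero_on_cell[OF mesh(2) nb(2) j L this] show ?thesis by auto
  qed
qed

section \<open>Integrals of cellwise smooth functions\<close>

lemma has_gradient_unique: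
  assumes "GDERIV f z :> D" "GDERIV f z :> D'"
  shows "D = D'"
proof -
  have "(\<lambda>h. h \<bullet> D) = (\<lambda>h. h \<bullet> D')"
    using assms unfolding gderiv_def by (rule has_derivative_unique)
  then have "\<forall>h. h \<bullet> D = h \<bullet> D'" by (simp add: fun_eq_iff)
  then show ?thesis by (simp only: vector_eq_ldot)
qed

lemma grad_eqI: "GDERIV f z :> D \<Longrightarrow> grad f z = D"
  unfolding grad_def by (rule the_equality) (auto intro: has_gradient_unique)

lemma has_gradient_transform_open:
  assumes "GDERIV g z :> D" "open S" "z \<in> S" "\<And>x. x \<in> S \<Longrightarrow> f x = g x"
  shows "GDERIV f z :> D"
  unfolding gderiv_def
  by (rule has_derivative_transform_within_open[OF assms(1)[unfolded gderiv_def] assms(2,3)])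
    (simp add: assms(4))

lemma has_gradient_sum:
  assumes "\<And>j. j \<in> J \<Longrightarrow> GDERIV (f j) z :> D j"
  shows "GDERIV (\<lambda>x. \<Sum>j\<in>J. f j x) z :> (\<Sum>j\<in>J. D j)"
  using assms unfolding gderiv_def inner_sum_right by (intro has_derivative_sum) auto

lemma real_polynomial_function_gradient:
  fixes p :: "'a::euclidean_space \<Rightarrow> real"
  assumes "real_polynomial_function p"
  shows "\<exists>g. continuous_on UNIV g \<and> (\<forall>x. GDERIV p x :> g x)"
  using assms
proof (induction rule: real_polynomial_function.induct)
  case (linear f)
  then have "h \<bullet> adjoint f 1 = f h" for h
    using adjoint_works[of f h 1] by (simp add: bounded_linear.linear)
  then have "GDERIV f x :> adjoint f 1" for x
    using bounded_linear_imp_has_derivative[OF linear] by (simp add: gderiv_def)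
  then show ?case by (intro exI[of _ "\<lambda>_. adjoint f 1"]) auto
next
  case (const c)
  then show ?case by (intro exI[of _ "\<lambda>_. 0"]) (auto intro: GDERIV_const)
next
  case (add f g)
  then obtain f' g' where "continuous_on UNIV f'" "continuous_on UNIV g'"
    "\<And>x. GDERIV f x :> f' x" "\<And>x. GDERIV g x :> g' x" by blast
  then show ?case
    by (intro exI[of _ "\<lambda>x. f' x + g' x"] conjI allI continuous_intros GDERIV_add)
next
  case (mult f g)
  then obtain f' g' where *: "continuous_on UNIV f'" "continuous_on UNIV g'"
    "\<And>x. GDERIV f x :> f' x" "\<And>x. GDERIV g x :> g' x" by blast
  have "continuous_on UNIV f" "continuous_on UNIV g"
    using mult.hyps by (auto intro: continuous_at_imp_continuous_on continuous_real_polymonial_function)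
  then show ?case using *
    by (intro exI[of _ "\<lambda>x. f x *\<^sub>R g' x + g x *\<^sub>R f' x"] conjI allI continuous_intros GDERIV_mult)
qed

lemma cellwise_continuous_absolutely_integrable:
  fixes h :: "'a::euclidean_space \<Rightarrow> real"
  assumes fin: "finite \<C>" and box: "\<And>K. K \<in> \<C> \<Longrightarrow> \<exists>p q. K = cbox p q"
    and h: "\<And>K. K \<in> \<C> \<Longrightarrow> \<exists>g. continuous_on K g \<and> (\<forall>x\<in>interior K. h x = g x)"
  shows "h absolutely_integrable_on \<Union>\<C>"
proof -
  have "h absolutely_integrable_on K" if K: "K \<in> \<C>" for K
  proof -
    obtain p q where pq: "K = cbox p q" using box[OF K] by blast
    obtain g where g: "continuous_on K g" "\<And>x. x \<in> interior K \<Longrightarrow> h x = g x" using h[OF K] by blast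
    have "g absolutely_integrable_on K"
      using g(1) unfolding pq by (rule absolutely_integrable_continuous)
    moreover have "negligible (frontier K)"
      unfolding pq by (rule negligible_convex_frontier) (rule convex_box)
    moreover have "h x = g x" if "x \<in> K - frontier K" for x
      using that g(2) closure_subset[of K] by (auto simp: frontier_def)
    ultimately show ?thesis by (rule absolutely_integrable_spike)
  qed
  moreover have "K \<in> sets lebesgue" if "K \<in> \<C>" for K
    using box[OF that] by auto
  ultimately have "set_integrable lebesgue (\<Union>(id ` \<C>)) h"
    using fin by (intro set_integrable_UN) auto
  then show ?thesis by simp
qed

lemma cellwise_zero_integral:
  fixes h :: "'a::euclidean_space \<Rightarrow> real"
  assumes fin: "finite \<C>" and box: "\<And>K. K \<in> \<C> \<Longrightarrow> \<exists>p q. K = cbox p q"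
    and h: "\<And>K x. K \<in> \<C> \<Longrightarrow> x \<in> interior K \<Longrightarrow> h x = 0"
  shows "integral (\<Union>\<C>) h = 0"
proof -
  have "negligible (\<Union>(frontier ` \<C>))"
  proof (rule negligible_Union)
    fix F assume "F \<in> frontier ` \<C>"
    then obtain p q :: 'a where "F = frontier (cbox p q)" using box by blast
    then show "negligible F" by (simp add: negligible_convex_frontier)
  qed (use fin in simp)
  moreover have "h x = 0" if x: "x \<in> \<Union>\<C> - \<Union>(frontier ` \<C>)" for x
  proof -
    obtain K where "K \<in> \<C>" "x \<in> K" "x \<notin> frontier K" using x by blast
    then show ?thesis using h closure_subset[of K] by (auto simp: frontier_def)
  qed
  ultimately have "integral (\<Union>\<C>) h = integral (\<Union>\<C>) (\<lambda>_. 0 :: real)"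
    by (intro integral_spike) auto
  then show ?thesis by simp
qed

text \<open>On the interior of every cell \<open>K\<close>, the integrand of an advection coefficient agrees with a
  function that is continuous on all of \<open>K\<close>; hence the integral is a genuine one and not the
  default value \<open>0\<close>. What happens on the cell boundaries is irrelevant.\<close>

lemma advection_integrand_absolutely_integrable:
  fixes \<beta> :: "'a::euclidean_space \<Rightarrow> 'a" and u w :: "'a \<Rightarrow> real"
  assumes fin: "finite \<C>" and box: "\<And>K. K \<in> \<C> \<Longrightarrow> \<exists>p q. K = cbox p q"
    and \<beta>: "\<And>K. K \<in> \<C> \<Longrightarrow> \<exists>b. continuous_on K b \<and> (\<forall>z\<in>interior K. \<beta> z = b z)"
    and u: "\<And>K. K \<in> \<C> \<Longrightarrow> \<exists>p. real_polynomial_function p \<and> (\<forall>z\<in>K. u z = p z)"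
    and w: "\<And>K. K \<in> \<C> \<Longrightarrow> \<exists>p. real_polynomial_function p \<and> (\<forall>z\<in>K. w z = p z)"
  shows "(\<lambda>z. (\<beta> z \<bullet> grad u z) * w z) absolutely_integrable_on \<Union>\<C>"
proof (rule cellwise_continuous_absolutely_integrable[OF fin box])
  fix K assume K: "K \<in> \<C>"
  obtain b where b: "continuous_on K b" "\<And>z. z \<in> interior K \<Longrightarrow> \<beta> z = b z"
    using \<beta>[OF K] by blast
  obtain p where p: "real_polynomial_function p" "\<And>z. z \<in> K \<Longrightarrow> u z = p z"
    using u[OF K] by blast
  obtain q where q: "real_polynomial_function q" "\<And>z. z \<in> K \<Longrightarrow> w z = q z"
    using w[OF K] by blast
  obtain g where g: "continuous_on UNIV g" "\<And>z. GDERIV p z :> g z"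
    using real_polynomial_function_gradient[OF p(1)] by blast
  have "continuous_on K (\<lambda>z. (b z \<bullet> g z) * q z)"
    using b(1) g(1) q(1)
    by (intro continuous_intros)
      (auto intro: continuous_on_subset continuous_at_imp_continuous_on
        continuous_real_polymonial_function)
  moreover have "(\<beta> z \<bullet> grad u z) * w z = (b z \<bullet> g z) * q z" if z: "z \<in> interior K" for z
  proof -
    have "GDERIV u z :> g z"
      using p(2) interior_subset[of K] by (auto intro!: has_gradient_transform_open[OF g(2) open_interior z])
    then show ?thesis
      using b(2)[OF z] q(2) z interior_subset[of K] by (auto simp: grad_eqI)
  qed
  ultimately show "\<exists>g. continuous_on K g \<and> (\<forall>z\<in>interior K. (\<beta> z \<bullet> grad u z) * w z = g z)"
    by blast
qed

text \<open>By the partition of unity, the integrands add up to zero inside every cell.\<close>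

lemma advection_coefficients_sum_zero:
  fixes \<beta> :: "'a::euclidean_space \<Rightarrow> 'a" and \<psi> :: "'i \<Rightarrow> 'a \<Rightarrow> real"
  assumes fin: "finite \<C>" and box: "\<And>K. K \<in> \<C> \<Longrightarrow> \<exists>p q. K = cbox p q"
    and \<beta>: "\<And>K. K \<in> \<C> \<Longrightarrow> \<exists>b. continuous_on K b \<and> (\<forall>z\<in>interior K. \<beta> z = b z)"
    and poly: "\<And>K j. K \<in> \<C> \<Longrightarrow> j \<in> J \<Longrightarrow> \<exists>p. real_polynomial_function p \<and> (\<forall>z\<in>K. \<psi> j z = p z)"
    and J: "finite J" "i \<in> J"
    and unity: "\<And>z. z \<in> \<Union>\<C> \<Longrightarrow> (\<Sum>j\<in>J. \<psi> j z) = 1"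
  shows "(\<Sum>j\<in>J. l2_inner (\<Union>\<C>) (\<lambda>z. \<beta> z \<bullet> grad (\<psi> j) z) (\<psi> i)) = 0"
proof -
  have int: "(\<lambda>z. (\<beta> z \<bullet> grad (\<psi> j) z) * \<psi> i z) absolutely_integrable_on \<Union>\<C>" if "j \<in> J" for j
    using poly that J(2) by (intro advection_integrand_absolutely_integrable fin box \<beta>) auto
  have "(\<Sum>j\<in>J. l2_inner (\<Union>\<C>) (\<lambda>z. \<beta> z \<bullet> grad (\<psi> j) z) (\<psi> i)) =
      (\<Sum>j\<in>J. integral (\<Union>\<C>) (\<lambda>z. (\<beta> z \<bullet> grad (\<psi> j) z) * \<psi> i z))"
    unfolding l2_inner_def by (intro sum.cong refl set_lebesgue_integral_eq_integral int)
  also have "\<dots> = integral (\<Union>\<C>) (\<lambda>z. \<Sum>j\<in>J. (\<beta> z \<bullet> grad (\<psi> j) z) * \<psi> i z)"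
    using int J(1) by (intro integral_sum[symmetric] set_lebesgue_integral_eq_integral(1))
  also have "\<dots> = 0"
  proof (rule cellwise_zero_integral[OF fin box])
    fix K z assume K: "K \<in> \<C>" and z: "z \<in> interior K"
    have "GDERIV (\<psi> j) z :> grad (\<psi> j) z" if j: "j \<in> J" for j
    proof -
      obtain p where p: "real_polynomial_function p" "\<And>z. z \<in> K \<Longrightarrow> \<psi> j z = p z"
        using poly[OF K j] by blast
      obtain g where g: "\<And>z. GDERIV p z :> g z"
        using real_polynomial_function_gradient[OF p(1)] by blast
      have "GDERIV (\<psi> j) z :> g z"
        using p(2) interior_subset[of K] by (auto intro!: has_gradient_transform_open[OF g open_interior z])
      then show ?thesis by (simp add: grad_eqI)
    qed
    then have "GDERIV (\<lambda>x. \<Sum>j\<in>J. \<psi> j x) z :> (\<Sum>j\<in>J. grad (\<psi> j) z)"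
      by (rule has_gradient_sum)
    moreover have "GDERIV (\<lambda>x. \<Sum>j\<in>J. \<psi> j x) z :> 0"
    proof (rule has_gradient_transform_open[OF GDERIV_const open_interior z])
      fix x assume "x \<in> interior K"
      then have "x \<in> \<Union>\<C>" using K interior_subset[of K] by blast
      then show "(\<Sum>j\<in>J. \<psi> j x) = 1" by (rule unity)
    qed
    ultimately have "(\<Sum>j\<in>J. grad (\<psi> j) z) = 0" by (rule has_gradient_unique)
    then show "(\<Sum>j\<in>J. (\<beta> z \<bullet> grad (\<psi> j) z) * \<psi> i z) = 0"
      by (simp flip: sum_distrib_right inner_sum_right)
  qed
  finally show ?thesis .
qed

text \<open>A function that vanishes on a cell has zero gradient in its interior.\<close>

lemma advection_coefficient_zero:
  fixes \<beta> :: "'a::euclidean_space \<Rightarrow> 'a" and u w :: "'a \<Rightarrow> real"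
  assumes fin: "finite \<C>" and box: "\<And>K. K \<in> \<C> \<Longrightarrow> \<exists>p q. K = cbox p q"
    and zero: "\<And>K. K \<in> \<C> \<Longrightarrow> (\<forall>z\<in>K. u z = 0) \<or> (\<forall>z\<in>K. w z = 0)"
  shows "l2_inner (\<Union>\<C>) (\<lambda>z. \<beta> z \<bullet> grad u z) w = 0"
proof -
  have 0: "(\<beta> z \<bullet> grad u z) * w z = 0" if K: "K \<in> \<C>" and z: "z \<in> interior K" for K z
    using zero[OF K]
  proof
    assume u: "\<forall>z\<in>K. u z = 0"
    have "GDERIV u z :> 0"
      using u interior_subset[of K]
      by (auto intro!: has_gradient_transform_open[OF GDERIV_const[of 0] open_interior z])
    then show ?thesis by (simp add: grad_eqI)
  next
    assume "\<forall>z\<in>K. w z = 0"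
    then show ?thesis using z interior_subset[of K] by auto
  qed
  have "(\<lambda>z. (\<beta> z \<bullet> grad u z) * w z) absolutely_integrable_on \<Union>\<C>"
    using 0 by (intro cellwise_continuous_absolutely_integrable[OF fin box])
      (auto intro!: exI[of _ "\<lambda>_. 0"])
  then show ?thesis
    unfolding l2_inner_def using cellwise_zero_integral[OF fin box 0]
    by (simp add: set_lebesgue_integral_eq_integral)
qed

lemma l2_inner_self_pos:
  fixes u :: "'a::euclidean_space \<Rightarrow> real"
  assumes cont: "continuous_on (cbox a b) u" and box: "box a b \<noteq> {}"
    and z: "z \<in> cbox a b" "u z \<noteq> 0"
  shows "0 < l2_inner (cbox a b) u u"
proof -
  have cont2: "continuous_on (cbox a b) (\<lambda>x. u x * u x)" by (intro continuous_intros cont)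
  have eq: "l2_inner (cbox a b) u u = integral (cbox a b) (\<lambda>x. u x * u x)"
    unfolding l2_inner_def
    by (rule set_lebesgue_integral_eq_integral(2)[OF absolutely_integrable_continuous[OF cont2]])
  have "integral (cbox a b) (\<lambda>x. u x * u x) \<noteq> 0"
    using integral_cbox_eq_0_iff[OF cont2 box] z by auto
  moreover have "0 \<le> integral (cbox a b) (\<lambda>x. u x * u x)"
    by (rule integral_nonneg[OF integrable_continuous[OF cont2]]) simp
  ultimately show ?thesis using eq by simp
qed

lemma l2_inner_nonneg:
  assumes "\<And>z. z \<in> S \<Longrightarrow> 0 \<le> u z" "\<And>z. z \<in> S \<Longrightarrow> 0 \<le> w z"
  shows "0 \<le> l2_inner S u w"
  unfolding l2_inner_def set_lebesgue_integral_def
  by (rule Bochner_Integration.integral_nonneg) (auto simp: indicator_def assms)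

section \<open>Cellwise smoothness of the basis and of the velocity field\<close>

lemma Q1_poly_on_real_polynomial:
  fixes u :: "'a::euclidean_space \<Rightarrow> real"
  assumes "Q1_poly_on K u"
  shows "\<exists>p. real_polynomial_function p \<and> (\<forall>x\<in>K. u x = p x)"
proof -
  obtain c where c: "\<And>x. x \<in> K \<Longrightarrow> u x = (\<Sum>S\<in>Pow Basis. c S * (\<Prod>k\<in>S. x \<bullet> k))"
    using assms unfolding Q1_poly_on_def by blast
  have "real_polynomial_function (\<lambda>x. \<Sum>S\<in>Pow (Basis :: 'a set). c S * (\<Prod>k\<in>S. x \<bullet> k))"
  proof (rule real_polynomial_function_sum)
    show "finite (Pow (Basis :: 'a set))" by simp
    fix S assume S: "S \<in> Pow (Basis :: 'a set)"
    then have "finite S" using finite_Basis by (meson PowD finite_subset)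
    then have "real_polynomial_function (\<lambda>x. \<Prod>k\<in>S. x \<bullet> k)"
      by (rule real_polynomial_function_prod)
        (rule real_polynomial_function.intros(1)[OF bounded_linear_inner_left])
    then show "real_polynomial_function (\<lambda>x. c S * (\<Prod>k\<in>S. x \<bullet> k))"
      by (rule real_polynomial_function.intros(4)[OF real_polynomial_function.intros(2)])
  qed
  then show ?thesis using c by blast
qed

lemma tensor_product_real_polynomial:
  fixes u :: "'a::euclidean_space \<Rightarrow> real" and w :: "'b::euclidean_space \<Rightarrow> real"
  assumes "Q1_poly_on K u" "Q1_poly_on L w"
  shows "\<exists>p. real_polynomial_function p \<and> (\<forall>z\<in>K \<times> L. (\<lambda>(x, v). u x * w v) z = p z)"
proof -
  obtain p where p: "real_polynomial_function p" "\<And>x. x \<in> K \<Longrightarrow> u x = p x"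
    using Q1_poly_on_real_polynomial[OF assms(1)] by blast
  obtain q where q: "real_polynomial_function q" "\<And>v. v \<in> L \<Longrightarrow> w v = q v"
    using Q1_poly_on_real_polynomial[OF assms(2)] by blast
  have "real_polynomial_function (p \<circ> fst :: 'a \<times> 'b \<Rightarrow> real)"
    by (rule real_polynomial_function_compose[OF
          polynomial_function_bounded_linear[OF bounded_linear_fst] p(1)])
  moreover have "real_polynomial_function (q \<circ> snd :: 'a \<times> 'b \<Rightarrow> real)"
    by (rule real_polynomial_function_compose[OF
          polynomial_function_bounded_linear[OF bounded_linear_snd] q(1)])
  ultimately have "real_polynomial_function (\<lambda>z. (p \<circ> fst) z * (q \<circ> snd) z)"
    by (rule real_polynomial_function.intros(4))
  moreover have "\<forall>z\<in>K \<times> L. (\<lambda>(x, v). u x * w v) z = (p \<circ> fst) z * (q \<circ> snd) z"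
    using p(2) q(2) by (simp add: case_prod_beta mem_Times_iff)
  ultimately show ?thesis by blast
qed

lemma continuous_on_vlasov_field:
  assumes "continuous_on UNIV E" "continuous_on UNIV B"
  shows "continuous_on S (vlasov_field \<iota>x \<iota>v E B)"
proof -
  have emb: "continuous_on S (\<lambda>z. embed3 \<iota>v (snd z))"
    unfolding embed3_def by (intro continuous_intros)
  have E: "continuous_on S (\<lambda>z. E (fst z))" and B: "continuous_on S (\<lambda>z. B (fst z))"
    using assms[THEN continuous_on_compose2, OF continuous_on_fst[OF continuous_on_id], of S]
    by simp_all
  show ?thesis
    unfolding vlasov_field_def case_prod_beta
    by (intro continuous_on_Pair continuous_on_vec_lambda continuous_on_component
        continuous_on_add continuous_on_cross emb E B)
qed

lemma vlasov_field_cellwise_continuous: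
  assumes E: "fe_field T E" and B: "fe_field T B" and K: "K \<in> T"
  shows "\<exists>b. continuous_on (K \<times> L) b \<and> (\<forall>z\<in>interior (K \<times> L). vlasov_field \<iota>x \<iota>v E B z = b z)"
proof -
  obtain e where e: "polynomial_function e" "\<And>x. x \<in> interior K \<Longrightarrow> E x = e x"
    using bspec[OF E[unfolded fe_field_def] K] by blast
  obtain b where b: "polynomial_function b" "\<And>x. x \<in> interior K \<Longrightarrow> B x = b x"
    using bspec[OF B[unfolded fe_field_def] K] by blast
  have "continuous_on (K \<times> L) (vlasov_field \<iota>x \<iota>v e b)"
    using e(1) b(1) by (intro continuous_on_vlasov_field continuous_on_polymonial_function)
  moreover have "\<forall>z\<in>interior (K \<times> L). vlasov_field \<iota>x \<iota>v E B z = vlasov_field \<iota>x \<iota>v e b z"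
    using e(2) b(2) by (auto simp: vlasov_field_def interior_Times)
  ultimately show ?thesis by blast
qed

section \<open>Convex combinations under the CFL condition\<close>

text \<open>One row of the low-order scheme, with \<open>g\<close> for the new value at node \<open>i\<close>.\<close>

lemma low_order_update_lower_bound:
  fixes c d f :: "'i \<Rightarrow> real"
  assumes J: "finite J" "i \<in> J"
    and dom: "\<And>j. j \<in> J - {i} \<Longrightarrow> \<bar>c j\<bar> \<le> d j"
    and c: "(\<Sum>j\<in>J. c j) = 0" and d: "d i = - (\<Sum>j\<in>J - {i}. d j)"
    and pos: "0 < m" "0 < \<tau>" and cfl: "2 * \<tau> * (\<Sum>j\<in>J - {i}. d j) \<le> m"
    and scheme: "m * ((g - f i) / \<tau>) + (\<Sum>j\<in>J. c j * f j) - (\<Sum>j\<in>J. d j * f j) = 0"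
    and lo: "\<And>j. j \<in> J \<Longrightarrow> lo \<le> f j"
  shows "lo \<le> g"
proof -
  define w where "w j = d j - c j" for j
  define W where "W = (\<Sum>j\<in>J - {i}. w j)"
  have w: "0 \<le> w j" "w j \<le> 2 * d j" if "j \<in> J - {i}" for j
    using dom[OF that] by (auto simp: w_def)
  have "W \<le> 2 * (\<Sum>j\<in>J - {i}. d j)"
    unfolding W_def sum_distrib_left by (rule sum_mono) (rule w)
  then have "\<tau> * W \<le> \<tau> * (2 * (\<Sum>j\<in>J - {i}. d j))" using pos by simp
  then have weight: "\<tau> * W \<le> m" using cfl by linarith
  have wi: "w i = - W"
    using c d unfolding w_def W_def sum_subtractf by (simp add: sum.remove[OF J])
  have "(\<Sum>j\<in>J. d j * f j) - (\<Sum>j\<in>J. c j * f j) = (\<Sum>j\<in>J. w j * f j)"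
    by (simp add: w_def left_diff_distrib sum_subtractf)
  also have "\<dots> = (\<Sum>j\<in>J - {i}. w j * f j) - W * f i"
    using wi by (simp add: sum.remove[OF J])
  finally have "m * ((g - f i) / \<tau>) = (\<Sum>j\<in>J - {i}. w j * f j) - W * f i"
    using scheme by simp
  then have upd: "m * g = (m - \<tau> * W) * f i + \<tau> * (\<Sum>j\<in>J - {i}. w j * f j)"
    using pos by (simp add: field_simps)
  have "W * lo \<le> (\<Sum>j\<in>J - {i}. w j * f j)"
    unfolding W_def sum_distrib_right using w lo by (intro sum_mono mult_left_mono) auto
  then have "\<tau> * (W * lo) \<le> \<tau> * (\<Sum>j\<in>J - {i}. w j * f j)" using pos by simp
  moreover have "(m - \<tau> * W) * lo \<le> (m - \<tau> * W) * f i"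
    using weight lo J by (intro mult_left_mono) auto
  ultimately have "m * lo \<le> m * g"
    using upd by (simp add: algebra_simps)
  then show ?thesis using pos by simp
qed

lemma low_order_update_bounds:
  fixes c d f :: "'i \<Rightarrow> real"
  assumes J: "finite J" "i \<in> J"
    and dom: "\<And>j. j \<in> J - {i} \<Longrightarrow> \<bar>c j\<bar> \<le> d j"
    and c: "(\<Sum>j\<in>J. c j) = 0" and d: "d i = - (\<Sum>j\<in>J - {i}. d j)"
    and pos: "0 < m" "0 < \<tau>" and cfl: "2 * \<tau> * (\<Sum>j\<in>J - {i}. d j) \<le> m"
    and scheme: "m * ((g - f i) / \<tau>) + (\<Sum>j\<in>J. c j * f j) - (\<Sum>j\<in>J. d j * f j) = 0"
  shows "Min (f ` J) \<le> g" "g \<le> Max (f ` J)"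
proof -
  show "Min (f ` J) \<le> g"
    by (rule low_order_update_lower_bound[OF J dom c d pos cfl scheme]) (use J in auto)
  \<comment> \<open>The scheme is linear, so the upper bound is the lower bound for \<open>- f\<close>.\<close>
  have "m * ((- g - (- f i)) / \<tau>) = - (m * ((g - f i) / \<tau>))"
    using pos by (simp add: field_simps)
  then have "m * ((- g - (- f i)) / \<tau>) + (\<Sum>j\<in>J. c j * - f j) - (\<Sum>j\<in>J. d j * - f j) = 0"
    using scheme by (simp add: sum_negf)
  from low_order_update_lower_bound[OF J dom c d pos cfl this, of "- Max (f ` J)"]
  show "g \<le> Max (f ` J)" using J by auto
qed

text \<open>A vanishing viscosity sum \<open>D i = 0\<close> contributes the quotient \<open>\<infinity>\<close> to the minimum, hence no
  restriction on the time step.\<close>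

lemma cfl_time_step:
  fixes m D :: "'i \<Rightarrow> real"
  assumes A: "finite A" "A \<noteq> {}" and m: "\<And>i. i \<in> A \<Longrightarrow> 0 < m i" and D: "\<And>i. i \<in> A \<Longrightarrow> 0 \<le> D i"
    and \<tau>: "ereal \<tau> = ereal cfl * (MIN i\<in>A. ereal (m i) / ereal (D i))" and cfl: "0 < cfl"
  shows "0 < \<tau>" "\<And>i. i \<in> A \<Longrightarrow> \<tau> * D i \<le> cfl * m i"
proof -
  define Q where "Q i = ereal (m i) / ereal (D i)" for i
  have Qpos: "0 < Q i" if "i \<in> A" for i
    using m[OF that] D[OF that] by (cases "D i = 0") (auto simp: Q_def)
  have "0 < Min (Q ` A)"
    using A Qpos by (subst Min_gr_iff) auto
  then have "0 < ereal \<tau>"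
    unfolding \<tau> Q_def[symmetric] using cfl by (simp add: ereal_zero_less_0_iff)
  then show "0 < \<tau>" by simp
  fix i assume i: "i \<in> A"
  show "\<tau> * D i \<le> cfl * m i"
  proof (cases "D i = 0")
    case True
    then show ?thesis using cfl m[OF i] by simp
  next
    case False
    then have Di: "0 < D i" using D[OF i] by simp
    have "Min (Q ` A) \<le> Q i" using A i by simp
    then have "ereal \<tau> \<le> ereal cfl * Q i"
      unfolding \<tau> Q_def[symmetric] using cfl by (intro ereal_mult_left_mono) auto
    then have "\<tau> \<le> cfl * (m i / D i)" using Di by (simp add: Q_def)
    then show ?thesis using Di by (simp add: field_simps)
  qed
qed

section \<open>Local bounds for the low-order scheme\<close>

theorem proposition3p1:
  fixes ax bx :: "real ^ 'm::finite" and av bv :: "real ^ 'n::finite"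
    and Tx :: "(real ^ 'm) set set" and Tv :: "(real ^ 'n) set set"
    and Nx Nv N :: nat
    and yx :: "nat \<Rightarrow> real ^ 'm" and yv :: "nat \<Rightarrow> real ^ 'n"
    and \<phi> :: "nat \<Rightarrow> real ^ 'm \<Rightarrow> real" and \<theta> :: "nat \<Rightarrow> real ^ 'n \<Rightarrow> real"
    and y :: "nat \<Rightarrow> (real ^ 'm) \<times> (real ^ 'n)"
    and \<psi> :: "nat \<Rightarrow> (real ^ 'm) \<times> (real ^ 'n) \<Rightarrow> real"
    and \<iota>x :: "'m \<Rightarrow> 3" and \<iota>v :: "'n \<Rightarrow> 3"
    and E B :: "real ^ 'm \<Rightarrow> real ^ 3"
    and \<Omega> :: "((real ^ 'm) \<times> (real ^ 'n)) set"
    and \<beta> :: "(real ^ 'm) \<times> (real ^ 'n) \<Rightarrow> (real ^ 'm) \<times> (real ^ 'n)"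
    and I :: "nat \<Rightarrow> nat set"
    and M c d :: "nat \<Rightarrow> nat \<Rightarrow> real" and m :: "nat \<Rightarrow> real"
    and fh :: "(real ^ 'm) \<times> (real ^ 'n) \<Rightarrow> real"
    and f fL :: "nat \<Rightarrow> real" and \<tau> cfl :: real
  assumes mesh_x: "cuboid_mesh ax bx Tx" and mesh_v: "cuboid_mesh av bv Tv"
    and basis_x: "nodal_basis ax bx Tx Nx yx \<phi>" and basis_v: "nodal_basis av bv Tv Nv yv \<theta>"
    and N: "N = Nx * Nv"
    and nodes: "\<And>i j. i \<in> {1..Nx} \<Longrightarrow> j \<in> {1..Nv} \<Longrightarrow> y ((i - 1) * Nv + j) = (yx i, yv j)"
    and basis: "\<And>i j. i \<in> {1..Nx} \<Longrightarrow> j \<in> {1..Nv} \<Longrightarrow>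
                  \<psi> ((i - 1) * Nv + j) = (\<lambda>(x, v). \<phi> i x * \<theta> j v)"
    and axes: "inj \<iota>x" "inj \<iota>v" "range \<iota>x \<subseteq> range \<iota>v"
    and fields: "fe_field Tx E" "fe_field Tx B"
    and Omega: "\<Omega> = cbox ax bx \<times> cbox av bv"
    and beta: "\<beta> = vlasov_field \<iota>x \<iota>v E B"
    and I: "\<And>i. I i = stencil N y \<psi> i"
    and M: "\<And>i j. M i j = l2_inner \<Omega> (\<psi> j) (\<psi> i)"
    and m: "\<And>i. m i = (\<Sum>j\<in>I i. M i j)"
    and c: "\<And>i j. c i j = l2_inner \<Omega> (\<lambda>z. \<beta> z \<bullet> grad (\<psi> j) z) (\<psi> i)"
    and d_off: "\<And>i j. j \<noteq> i \<Longrightarrow> d i j = max \<bar>c i j\<bar> \<bar>c j i\<bar>"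
    and d_diag: "\<And>i. d i i = - (\<Sum>j\<in>I i - {i}. d i j)"
    and fh: "fh \<in> tensor_space (Q1_space ax bx Tx) (Q1_space av bv Tv)"
            "fh = (\<lambda>z. \<Sum>j=1..N. f j * \<psi> j z)"
    and scheme: "\<And>i. i \<in> {1..N} \<Longrightarrow>
                  m i * ((fL i - f i) / \<tau>) + (\<Sum>j\<in>I i. c i j * f j) - (\<Sum>j\<in>I i. d i j * f j) = 0"
    and CFL: "ereal \<tau> = ereal cfl * (MIN i\<in>{1..N}. ereal (m i) / ereal (\<Sum>j\<in>I i - {i}. d i j))"
    and cfl: "0 < cfl" "cfl \<le> 1 / 2"
  shows "\<forall>i\<in>{1..N}. Min (f ` I i) \<le> fL i \<and> fL i \<le> Max (f ` I i)"
proof -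
  define \<C> where "\<C> = (\<lambda>(K, L). K \<times> L) ` (Tx \<times> Tv)"
  have fin: "finite \<C>"
    using mesh_x mesh_v unfolding \<C>_def cuboid_mesh_def
    by (intro finite_imageI finite_cartesian_product) (auto intro: division_of_finite)
  have \<C>E: "\<exists>K\<in>Tx. \<exists>L\<in>Tv. C = K \<times> L" if "C \<in> \<C>" for C
    using that by (auto simp: \<C>_def)
  have box: "\<exists>p q. C = cbox p q" if C: "C \<in> \<C>" for C
  proof -
    obtain K L where KL: "K \<in> Tx" "L \<in> Tv" "C = K \<times> L" using \<C>E[OF C] by blast
    obtain p q where "K = cbox p q" by (rule cuboid_mesh_cellE[OF mesh_x KL(1)])
    moreover obtain p' q' where "L = cbox p' q'" by (rule cuboid_mesh_cellE[OF mesh_v KL(2)])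
    ultimately have "C = cbox (p, p') (q, q')" using KL(3) by (simp add: cbox_Pair_eq)
    then show ?thesis by blast
  qed
  have Union: "\<Union>\<C> = \<Omega>"
  proof -
    have "\<Union>\<C> = \<Union>Tx \<times> \<Union>Tv" unfolding \<C>_def by auto
    then show ?thesis by (simp add: Omega cuboid_mesh_Union[OF mesh_x] cuboid_mesh_Union[OF mesh_v])
  qed
  have \<Omega>_cbox: "\<Omega> = cbox (ax, av) (bx, bv)" by (simp add: Omega cbox_Pair_eq)
  have \<Omega>_interior: "box (ax, av) (bx, bv) \<noteq> {}"
  proof -
    have "box (ax, av) (bx, bv) = box ax bx \<times> box av bv"
      unfolding interior_cbox[symmetric] cbox_Pair_eq interior_Times ..
    then show ?thesis using mesh_x mesh_v by (simp add: cuboid_mesh_def)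
  qed
  have Q1_x: "\<phi> i \<in> Q1_space ax bx Tx" if "i \<in> {1..Nx}" for i
    using basis_x that by (simp add: nodal_basis_def)
  have Q1_v: "\<theta> j \<in> Q1_space av bv Tv" if "j \<in> {1..Nv}" for j
    using basis_v that by (simp add: nodal_basis_def)

  have field: "\<exists>b. continuous_on C b \<and> (\<forall>z\<in>interior C. \<beta> z = b z)" if C: "C \<in> \<C>" for C
  proof -
    obtain K L where KL: "K \<in> Tx" "L \<in> Tv" "C = K \<times> L" using \<C>E[OF C] by blast
    show ?thesis
      unfolding beta KL(3) by (rule vlasov_field_cellwise_continuous[OF fields KL(1)])
  qed
  have poly: "\<exists>p. real_polynomial_function p \<and> (\<forall>z\<in>C. \<psi> k z = p z)"
    if C: "C \<in> \<C>" and k: "k \<in> {1..N}" for C k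
  proof -
    obtain K L where KL: "K \<in> Tx" "L \<in> Tv" "C = K \<times> L" using \<C>E[OF C] by blast
    obtain i j where ij: "i \<in> {1..Nx}" "j \<in> {1..Nv}" "k = (i - 1) * Nv + j"
      using tensor_index_decompose k unfolding N by blast
    have "Q1_poly_on K (\<phi> i)" "Q1_poly_on L (\<theta> j)"
      using Q1_x[OF ij(1)] Q1_v[OF ij(2)] KL by (simp_all add: Q1_space_def)
    then show ?thesis
      unfolding ij(3) basis[OF ij(1,2)] KL(3) by (rule tensor_product_real_polynomial)
  qed
  have unity: "(\<Sum>k=1..N. \<psi> k z) = 1" if "z \<in> \<Omega>" for z
  proof -
    obtain x v where z: "z = (x, v)" "x \<in> cbox ax bx" "v \<in> cbox av bv"
      using \<open>z \<in> \<Omega>\<close> Omega by blast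
    have "(\<Sum>k=1..N. \<psi> k z) = (\<Sum>i=1..Nx. \<Sum>j=1..Nv. \<phi> i x * \<theta> j v)"
      unfolding N sum_tensor_index by (intro sum.cong refl) (use basis z(1) in simp)
    also have "\<dots> = (\<Sum>i=1..Nx. \<phi> i x) * (\<Sum>j=1..Nv. \<theta> j v)"
      by (simp add: sum_product)
    also have "\<dots> = 1"
      using nodal_basis_partition_of_unity[OF mesh_x basis_x z(2)]
        nodal_basis_partition_of_unity[OF mesh_v basis_v z(3)] by simp
    finally show ?thesis .
  qed
  have row_sum_all: "(\<Sum>j=1..N. c i j) = 0" if i: "i \<in> {1..N}" for i
    unfolding c Union[symmetric]
    by (rule advection_coefficients_sum_zero[OF fin box field poly _ i]) (use unity Union in simp_all)

  have off_stencil: "c i j = 0" if i: "i \<in> {1..N}" and j: "j \<in> {1..N}" and out: "j \<notin> I i" for i j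
    unfolding c Union[symmetric]
  proof (rule advection_coefficient_zero[OF fin box])
    fix C assume "C \<in> \<C>"
    then obtain K L where KL: "K \<in> Tx" "L \<in> Tv" "C = K \<times> L" using \<C>E by blast
    obtain p q where i': "p \<in> {1..Nx}" "q \<in> {1..Nv}" "i = (p - 1) * Nv + q"
      using tensor_index_decompose i unfolding N by blast
    obtain r s where j': "r \<in> {1..Nx}" "s \<in> {1..Nv}" "j = (r - 1) * Nv + s"
      using tensor_index_decompose j unfolding N by blast
    have "y j \<notin> closure {z. \<psi> i z \<noteq> 0}" using out j by (simp add: I stencil_def)
    then have "(yx r, yv s) \<notin> closure {z. (\<lambda>(x, v). \<phi> p x * \<theta> q v) z \<noteq> 0}"
      by (simp only: i'(3) j'(3) basis[OF i'(1,2)] nodes[OF j'(1,2)] not_False_eq_True)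
    from tensor_basis_zero_on_cell[OF mesh_x mesh_v basis_x basis_v
        i'(1) j'(1) i'(2) j'(2) KL(1,2) this]
    show "(\<forall>z\<in>C. \<psi> j z = 0) \<or> (\<forall>z\<in>C. \<psi> i z = 0)"
      unfolding i'(3) j'(3) basis[OF i'(1,2)] basis[OF j'(1,2)] KL(3) by blast
  qed
  have I_subset: "I i \<subseteq> {1..N}" for i by (auto simp: I stencil_def)
  then have I_fin: "finite (I i)" for i by (rule finite_subset) simp
  have row_sum: "(\<Sum>j\<in>I i. c i j) = 0" if i: "i \<in> {1..N}" for i
  proof -
    have "(\<Sum>j\<in>I i. c i j) = (\<Sum>j=1..N. c i j)"
      using off_stencil[OF i] I_subset by (intro sum.mono_neutral_left) auto
    then show ?thesis using row_sum_all[OF i] by simp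
  qed

  have node: "y k \<in> \<Omega>" "\<psi> k (y k) = 1" "continuous_on \<Omega> (\<psi> k)" if k: "k \<in> {1..N}" for k
  proof -
    obtain i j where ij: "i \<in> {1..Nx}" "j \<in> {1..Nv}" "k = (i - 1) * Nv + j"
      using tensor_index_decompose k unfolding N by blast
    have yk: "y k = (yx i, yv j)" and \<psi>k: "\<psi> k = (\<lambda>(x, v). \<phi> i x * \<theta> j v)"
      using nodes[OF ij(1,2)] basis[OF ij(1,2)] ij(3) by simp_all
    have "yx i \<in> mesh_nodes ax bx Tx" "yv j \<in> mesh_nodes av bv Tv"
      using basis_x basis_v ij unfolding nodal_basis_def bij_betw_def by blast+
    from this[THEN mesh_nodes_subset[THEN subsetD]] show "y k \<in> \<Omega>"
      unfolding yk Omega by blast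
    show "\<psi> k (y k) = 1"
      using basis_x basis_v ij yk \<psi>k by (simp add: nodal_basis_def)
    have "continuous_on UNIV (\<phi> i)" "continuous_on UNIV (\<theta> j)"
      using Q1_x[OF ij(1)] Q1_v[OF ij(2)] by (simp_all add: Q1_space_def)
    then show "continuous_on \<Omega> (\<psi> k)"
      unfolding \<psi>k case_prod_beta
      by (intro continuous_on_mult continuous_on_compose2[of UNIV "\<phi> i" \<Omega> fst]
          continuous_on_compose2[of UNIV "\<theta> j" \<Omega> snd] continuous_on_fst continuous_on_snd
          continuous_on_id subset_UNIV)
  qed
  have \<psi>_nonneg: "0 \<le> \<psi> k z" if k: "k \<in> {1..N}" and z: "z \<in> \<Omega>" for k z
  proof -
    obtain i j where ij: "i \<in> {1..Nx}" "j \<in> {1..Nv}" "k = (i - 1) * Nv + j"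
      using tensor_index_decompose k unfolding N by blast
    obtain x v where xv: "z = (x, v)" "x \<in> cbox ax bx" "v \<in> cbox av bv"
      using z Omega by blast
    show ?thesis
      unfolding ij(3) basis[OF ij(1,2)] xv(1)
      using nodal_basis_nonneg[OF mesh_x basis_x ij(1) xv(2)]
        nodal_basis_nonneg[OF mesh_v basis_v ij(2) xv(3)] by simp
  qed
  have self: "i \<in> I i" if i: "i \<in> {1..N}" for i
  proof -
    have "y i \<in> {z. \<psi> i z \<noteq> 0}" using node(2)[OF i] by simp
    from subsetD[OF closure_subset this] i show ?thesis by (simp add: I stencil_def)
  qed
  have m_pos: "0 < m i" if i: "i \<in> {1..N}" for i
  proof -
    have "0 < M i i"
      unfolding M \<Omega>_cbox
      using node[OF i] by (intro l2_inner_self_pos[OF _ \<Omega>_interior]) (auto simp: \<Omega>_cbox)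
    also have "M i i \<le> (\<Sum>j\<in>I i. M i j)"
    proof (rule member_le_sum[OF self[OF i] _ I_fin])
      fix j assume "j \<in> I i - {i}"
      then have "j \<in> {1..N}" using I_subset by blast
      then show "0 \<le> M i j"
        unfolding M by (intro l2_inner_nonneg \<psi>_nonneg i)
    qed
    finally show ?thesis unfolding m .
  qed

  have dom: "\<bar>c i j\<bar> \<le> d i j" if "j \<in> I i - {i}" for i j
    using d_off[of j i] that by auto
  have D_nonneg: "0 \<le> (\<Sum>j\<in>I i - {i}. d i j)" for i
  proof (rule sum_nonneg)
    fix j assume "j \<in> I i - {i}"
    from dom[OF this] show "0 \<le> d i j" by linarith
  qed
  show ?thesis
  proof
    fix i assume i: "i \<in> {1..N}"
    have "0 < \<tau>" and step: "\<tau> * (\<Sum>j\<in>I i - {i}. d i j) \<le> cfl * m i"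
      using cfl_time_step[OF _ _ m_pos D_nonneg CFL cfl(1)] i by auto
    have "cfl * m i \<le> 1 / 2 * m i"
      using cfl(2) m_pos[OF i] by (intro mult_right_mono) auto
    then have "2 * \<tau> * (\<Sum>j\<in>I i - {i}. d i j) \<le> m i" using step by linarith
    from low_order_update_bounds[where c = "c i" and d = "d i", OF I_fin self[OF i] dom
        row_sum[OF i] d_diag m_pos[OF i] \<open>0 < \<tau>\<close> this scheme[OF i]]
    show "Min (f ` I i) \<le> fL i \<and> fL i \<le> Max (f ` I i)" by blast
  qed
qed

end
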